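(* For every integer $s \ge 1$, \[ \limsup_{n\to\infty} \frac{\alpha_s(H_2(n))}{2^n/n} = s-1. \]
   Context: $H_2(n)$ is the graph with vertex set $\{0,1\}^n$ in which $x,y$ are adjacent iff their Hamming distance $|\{i : x_i\ne y_i\}|$ is exactly $2$. For a graph $G$, $\alpha_s(G)$ denotes the maximum size of a vertex set $S\subseteq V(G)$ such that the induced subgraph $G[S]$ contains no copy of $K_s$. *)

theory Defs
  imports "HOL-Library.FuncSet" "HOL-Library.Extended_Real" "Graph_Theory.Graph_Theory"
begin

text \<open>
  Undirected simple graphs are the symmetric loop-free digraphs of \<open>Graph_Theory\<close>
  (locale \<open>graph\<close>): each edge is represented by the two arcs \<open>(x, y)\<close> and \<open>(y, x)\<close>.
  The points of $\{0,1\}^n$ are functions on \<open>{..<n}\<close>, extended by \<open>undefined\<close> outside.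
\<close>

definition hamming_dist :: "nat \<Rightarrow> (nat \<Rightarrow> nat) \<Rightarrow> (nat \<Rightarrow> nat) \<Rightarrow> nat" where
  "hamming_dist n x y = card {i \<in> {..<n}. x i \<noteq> y i}"

definition H2 :: "nat \<Rightarrow> (nat \<Rightarrow> nat, (nat \<Rightarrow> nat) \<times> (nat \<Rightarrow> nat)) pre_digraph" where
  "H2 n = with_proj
     \<lparr> pverts = {..<n} \<rightarrow>\<^sub>E {0, 1},
       parcs = {(x, y). x \<in> {..<n} \<rightarrow>\<^sub>E {0, 1} \<and> y \<in> {..<n} \<rightarrow>\<^sub>E {0, 1} \<and> hamming_dist n x y = 2} \<rparr>"

definition contains_complete :: "nat \<Rightarrow> ('a, 'b) pre_digraph \<Rightarrow> bool" where
  "contains_complete s G \<longleftrightarrow> (\<exists>K. subgraph K G \<and> complete_digraph s K)"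

text \<open>
  For finite \<open>G\<close> and \<open>s \<ge> 1\<close> the maximum is over a finite nonempty set (\<open>S = {}\<close> qualifies).
  For \<open>s = 0\<close> no \<open>S\<close> qualifies and the value is unspecified.
\<close>

definition alpha :: "nat \<Rightarrow> ('a, 'b) pre_digraph \<Rightarrow> nat" where
  "alpha s G = Max {card S | S. S \<subseteq> verts G \<and> \<not> contains_complete s (G \<restriction> S)}"

end

theory Submission
  imports Defs
begin

text \<open>
  The \<open>n\<close> points at Hamming distance \<open>1\<close> from a point form a clique of \<open>H2 n\<close>. A \<open>K\<^sub>s\<close>-free set
  meets each of these cliques in at most \<open>s - 1\<close> points, and double counting bounds its size by
  \<open>(s - 1) * 2 ^ n / n\<close> for every \<open>n\<close>. When \<open>n = 2 ^ r\<close>, label the coordinates by the vectors of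
  $\mathbb{F}_2^r$ and colour a point by the sum of the labels in its support: changing two
  coordinates changes the colour, so this is a proper colouring with \<open>n\<close> colours. Each colour class
  is independent, hence has at most \<open>2 ^ n / n\<close> points by the bound for \<open>s = 2\<close>, and therefore
  exactly that many. The union of \<open>s - 1\<close> classes is \<open>K\<^sub>s\<close>-free and attains the bound.
\<close>

section \<open>Points of the cube and cliques of \<open>H2 n\<close>\<close>

definition cube :: "nat \<Rightarrow> (nat \<Rightarrow> nat) set" where
  "cube n = {..<n} \<rightarrow>\<^sub>E {0, 1}"

lemma cube_cases: "x \<in> cube n \<Longrightarrow> i < n \<Longrightarrow> x i = 0 \<or> x i = 1"
  by (auto simp: cube_def PiE_iff)

lemma finite_cube: "finite (cube n)"
  by (simp add: cube_def finite_PiE)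

lemma card_cube: "card (cube n) = 2 ^ n"
  by (simp add: cube_def card_PiE numeral_2_eq_2)

lemma verts_H2: "verts (H2 n) = cube n"
  by (simp add: H2_def cube_def)

lemma hamming_dist_self: "hamming_dist n x x = 0"
  by (simp add: hamming_dist_def)

text \<open>The arcs of \<open>H2 n\<close> are exactly the ordered pairs at distance 2, so a
  complete subgraph amounts to its vertex set. Later arguments thus treat cliques as plain sets of
  points.\<close>

lemma contains_complete_H2_iff:
  assumes "S \<subseteq> cube n"
  shows "contains_complete s (H2 n \<restriction> S) \<longleftrightarrow>
    (\<exists>C\<subseteq>S. card C = s \<and> (\<forall>x\<in>C. \<forall>y\<in>C. x \<noteq> y \<longrightarrow> hamming_dist n x y = 2))"
proof
  assume "contains_complete s (H2 n \<restriction> S)"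
  then obtain K where sub: "subgraph K (H2 n \<restriction> S)" and K: "complete_digraph s K"
    by (auto simp: contains_complete_def)
  have "hamming_dist n x y = 2" if "x \<in> verts K" "y \<in> verts K" "x \<noteq> y" for x y
  proof -
    have "(x, y) \<in> arcs_ends K"
      using K that by (auto simp: complete_digraph_def)
    then obtain e where "e \<in> arcs K" "tail K e = x" "head K e = y"
      by (auto simp: arcs_ends_conv)
    then show ?thesis
      using sub by (auto simp: subgraph_def compatible_def H2_def)
  qed
  then show "\<exists>C\<subseteq>S. card C = s \<and> (\<forall>x\<in>C. \<forall>y\<in>C. x \<noteq> y \<longrightarrow> hamming_dist n x y = 2)"
    using sub K by (intro exI[of _ "verts K"]) (auto simp: subgraph_def complete_digraph_def)
next
  assume "\<exists>C\<subseteq>S. card C = s \<and> (\<forall>x\<in>C. \<forall>y\<in>C. x \<noteq> y \<longrightarrow> hamming_dist n x y = 2)"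
  then obtain C where C: "C \<subseteq> S" "card C = s"
    and clique: "\<forall>x\<in>C. \<forall>y\<in>C. x \<noteq> y \<longrightarrow> hamming_dist n x y = 2"
    by blast
  have "finite C"
    by (rule finite_subset[OF _ finite_cube[of n]]) (rule order.trans[OF C(1) assms])
  define K where "K = with_proj \<lparr> pverts = C, parcs = {(x, y). (x, y) \<in> C \<times> C \<and> x \<noteq> y} \<rparr>"
  have "complete_digraph s K"
    unfolding K_def complete_digraph_pair_def using \<open>finite C\<close> C(2) by simp
  moreover have "subgraph K (H2 n \<restriction> S)"
    using C(1) assms clique
    by (auto simp: subgraph_def compatible_def K_def H2_def wf_digraph_def subset_iff cube_def)
  ultimately show "contains_complete s (H2 n \<restriction> S)"
    by (auto simp: contains_complete_def)
qed

section \<open>The upper bound by double counting\<close>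

definition flip :: "(nat \<Rightarrow> nat) \<Rightarrow> nat \<Rightarrow> nat \<Rightarrow> nat" where
  "flip x i = x(i := 1 - x i)"

lemma flip_in_cube: "x \<in> cube n \<Longrightarrow> i < n \<Longrightarrow> flip x i \<in> cube n"
  by (auto simp: flip_def cube_def PiE_iff extensional_def)

text \<open>Truncated subtraction \<open>1 - x i\<close> swaps 0 and 1 but sends larger values to 0,
  hence the restriction to the cube.\<close>

lemma flip_flip: "x \<in> cube n \<Longrightarrow> i < n \<Longrightarrow> flip (flip x i) i = x"
  by (drule (1) cube_cases) (auto simp: flip_def)

lemma hamming_dist_flip_flip:
  assumes "x \<in> cube n" "i < n" "j < n" "i \<noteq> j"
  shows "hamming_dist n (flip x i) (flip x j) = 2"
proof -
  have "x i = 0 \<or> x i = 1" "x j = 0 \<or> x j = 1"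
    using assms cube_cases[of x n] by simp_all
  then have "{k \<in> {..<n}. flip x i k \<noteq> flip x j k} = {i, j}"
    using assms(2-4) by (auto simp: flip_def split: if_splits)
  then show ?thesis
    using assms(4) by (simp add: hamming_dist_def)
qed

lemma complete_free_card_bound:
  assumes S: "S \<subseteq> cube n" and free: "\<not> contains_complete s (H2 n \<restriction> S)" and "s \<ge> 1"
  shows "n * card S \<le> (s - 1) * 2 ^ n"
proof -
  define N where "N v = {i. i < n \<and> flip v i \<in> S}" for v
  have finN: "finite (N v)" for v
    by (simp add: N_def)
  have cardN: "card (N v) \<le> s - 1" if v: "v \<in> cube n" for v
  proof (rule ccontr)
    assume "\<not> card (N v) \<le> s - 1"
    then have "s \<le> card (N v)"
      by simp
    then obtain I where I: "I \<subseteq> N v" "card I = s"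
      by (elim obtain_subset_with_card_n)
    have dist: "hamming_dist n (flip v i) (flip v j) = 2" if "i \<in> I" "j \<in> I" "i \<noteq> j" for i j
      using that I(1) v by (intro hamming_dist_flip_flip) (auto simp: N_def)
    \<comment> \<open>Coinciding flips would be at distance 0, not 2.\<close>
    then have "inj_on (flip v) I"
      by (metis hamming_dist_self inj_onI zero_neq_numeral)
    then have "card (flip v ` I) = s"
      using I(2) by (simp add: card_image)
    moreover have "flip v ` I \<subseteq> S"
      using I(1) by (auto simp: N_def)
    ultimately have "contains_complete s (H2 n \<restriction> S)"
      unfolding contains_complete_H2_iff[OF S] using dist
      by (intro exI[of _ "flip v ` I"]) auto
    with free show False ..
  qed
  \<comment> \<open>Pairs of adjacent points of the cube with one end in \<open>S\<close> are
    counted twice: from the end in \<open>S\<close>, where each point has \<open>n\<close> flips,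
    and from the other end \<open>v\<close>, which has at most \<open>s - 1\<close> by
    \<open>cardN\<close>.\<close>
  have "bij_betw (\<lambda>(x, i). (flip x i, i)) (S \<times> {..<n}) (Sigma (cube n) N)"
  proof (rule bij_betw_byWitness[where f' = "\<lambda>(x, i). (flip x i, i)"])
    have "\<forall>x\<in>S. x \<in> cube n"
      using S by blast
    then show "\<forall>a\<in>S \<times> {..<n}. (case case a of (x, i) \<Rightarrow> (flip x i, i) of (x, i) \<Rightarrow> (flip x i, i)) = a"
      and "(\<lambda>(x, i). (flip x i, i)) ` (S \<times> {..<n}) \<subseteq> Sigma (cube n) N"
      by (simp_all add: N_def flip_flip[of _ n] flip_in_cube image_subset_iff split_beta)
    show "\<forall>a\<in>Sigma (cube n) N. (case case a of (x, i) \<Rightarrow> (flip x i, i) of (x, i) \<Rightarrow> (flip x i, i)) = a"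
      and "(\<lambda>(x, i). (flip x i, i)) ` Sigma (cube n) N \<subseteq> S \<times> {..<n}"
      by (simp_all add: N_def flip_flip[of _ n] image_subset_iff split_beta)
  qed
  then have "card (S \<times> {..<n}) = card (Sigma (cube n) N)"
    by (rule bij_betw_same_card)
  also have "\<dots> = (\<Sum>v\<in>cube n. card (N v))"
    by (rule card_SigmaI) (simp_all add: finite_cube finN)
  also have "\<dots> \<le> (\<Sum>v\<in>cube n. s - 1)"
    by (intro sum_mono cardN)
  finally show ?thesis
    by (simp add: card_cartesian_product card_cube mult.commute)
qed

text \<open>This makes the \<open>Max\<close> in \<open>alpha\<close> a genuine maximum: the cube
  has finitely many subsets, and the empty one contains no clique of size
  \<open>s \<ge> 1\<close>.\<close>

lemma alpha_H2_candidates: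
  assumes "s \<ge> 1"
  shows "finite {card S | S. S \<subseteq> verts (H2 n) \<and> \<not> contains_complete s (H2 n \<restriction> S)}" (is "finite ?A")
    and "{card S | S. S \<subseteq> verts (H2 n) \<and> \<not> contains_complete s (H2 n \<restriction> S)} \<noteq> {}"
proof -
  have "?A \<subseteq> card ` Pow (cube n)"
    by (auto simp: verts_H2)
  then show "finite ?A"
    by (rule finite_subset) (simp add: finite_cube)
  have "\<not> contains_complete s (H2 n \<restriction> {})"
    using assms by (subst contains_complete_H2_iff) auto
  then show "?A \<noteq> {}"
    by blast
qed

lemma alpha_H2_le:
  assumes "s \<ge> 1"
  shows "n * alpha s (H2 n) \<le> (s - 1) * 2 ^ n"
proof -
  have "alpha s (H2 n) \<in> {card S | S. S \<subseteq> verts (H2 n) \<and> \<not> contains_complete s (H2 n \<restriction> S)}"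
    unfolding alpha_def by (rule Max_in[OF alpha_H2_candidates[OF assms]])
  then show ?thesis
    using complete_free_card_bound assms by (auto simp: verts_H2)
qed

lemma card_le_alpha_H2:
  assumes "s \<ge> 1" "S \<subseteq> cube n" "\<not> contains_complete s (H2 n \<restriction> S)"
  shows "card S \<le> alpha s (H2 n)"
  unfolding alpha_def
  by (rule Max_ge[OF alpha_H2_candidates(1)]) (use assms in \<open>auto simp: verts_H2\<close>)

section \<open>The colouring for powers of two and the lower bound\<close>

text \<open>
  The set of nonzero coordinates of $\sum_{i < 2^r} x_i \cdot i \in \mathbb{F}_2^r$, where \<open>i\<close> is
  identified with its vector of binary digits.
\<close>

definition syndrome :: "nat \<Rightarrow> (nat \<Rightarrow> nat) \<Rightarrow> nat set" where
  "syndrome r x = {k \<in> {..<r}. odd (\<Sum>i | i < 2 ^ r \<and> bit i k. x i)}"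

lemma syndrome_in_Pow: "syndrome r x \<in> Pow {..<r}"
  by (auto simp: syndrome_def)

lemma exists_bit_neq:
  fixes i j :: nat
  assumes "i < 2 ^ r" "j < 2 ^ r" "i \<noteq> j"
  shows "\<exists>k<r. bit i k \<noteq> bit j k"
proof (rule ccontr)
  assume "\<not> ?thesis"
  then have "take_bit r i = take_bit r j"
    by (auto simp: bit_eq_iff bit_take_bit_iff)
  with assms show False
    by (simp add: take_bit_nat_eq_self)
qed

text \<open>The two changed coordinates have different labels, so some bit \<open>k\<close> is set
  in just one of them. Exactly one summand of the \<open>k\<close>-th parity then changes, and the
  parity flips.\<close>

lemma syndrome_proper:
  assumes x: "x \<in> cube (2 ^ r)" and y: "y \<in> cube (2 ^ r)" and dist: "hamming_dist (2 ^ r) x y = 2"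
  shows "syndrome r x \<noteq> syndrome r y"
proof -
  obtain i j where ij: "{k \<in> {..<2 ^ r}. x k \<noteq> y k} = {i, j}" "i \<noteq> j"
    using dist by (auto simp: hamming_dist_def card_2_iff)
  then have "i < 2 ^ r" "j < 2 ^ r"
    by auto
  then obtain k where k: "k < r" "bit i k \<noteq> bit j k"
    using exists_bit_neq ij(2) by blast
  then obtain p q where pq: "{k \<in> {..<2 ^ r}. x k \<noteq> y k} = {p, q}" "bit p k" "\<not> bit q k"
    using ij by (metis insert_commute)
  let ?B = "{i. i < 2 ^ r \<and> bit i k}"
  have p: "p \<in> ?B" "x p \<noteq> y p"
    using pq by auto
  have "x p = 0 \<or> x p = 1" "y p = 0 \<or> y p = 1"
    using cube_cases[OF x, of p] cube_cases[OF y, of p] p(1) by simp_all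
  with p(2) have "odd (x p) \<noteq> odd (y p)"
    by auto
  \<comment> \<open>The other changed coordinate \<open>q\<close> lies outside
    \<open>?B\<close>.\<close>
  moreover have "sum x (?B - {p}) = sum y (?B - {p})"
    using pq by (intro sum.cong) auto
  moreover have "sum x ?B = x p + sum x (?B - {p})" "sum y ?B = y p + sum y (?B - {p})"
    using p(1) by (simp_all add: sum.remove)
  ultimately have "odd (sum x ?B) \<noteq> odd (sum y ?B)"
    by simp
  then show ?thesis
    using k(1) by (auto simp: syndrome_def)
qed

text \<open>Pigeonhole: the points of a clique have distinct colours, all taken from
  \<open>T\<close>.\<close>

lemma syndrome_classes_complete_free:
  assumes "finite T" "card T < s"
  shows "\<not> contains_complete s (H2 (2 ^ r) \<restriction> {x \<in> cube (2 ^ r). syndrome r x \<in> T})"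
    (is "\<not> contains_complete s (_ \<restriction> ?S)")
proof
  assume "contains_complete s (H2 (2 ^ r) \<restriction> ?S)"
  moreover have "?S \<subseteq> cube (2 ^ r)"
    by blast
  ultimately obtain C where C: "C \<subseteq> ?S" "card C = s"
    and clique: "\<forall>x\<in>C. \<forall>y\<in>C. x \<noteq> y \<longrightarrow> hamming_dist (2 ^ r) x y = 2"
    unfolding contains_complete_H2_iff[OF \<open>?S \<subseteq> cube (2 ^ r)\<close>] by blast
  have "inj_on (syndrome r) C"
    by (intro inj_onI ccontr[of "_ = _"]) (use C(1) clique syndrome_proper in blast)
  then have "card C \<le> card T"
    using C(1) assms(1) by (intro card_inj_on_le[of "syndrome r"]) auto
  then show False
    using C(2) assms(2) by simp
qed

text \<open>Class sizes are never computed. The \<open>n - (s - 1)\<close> colours outside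
  \<open>T\<close> cover at most \<open>2 ^ n / n\<close> points each, which leaves enough points
  for the classes in \<open>T\<close>.\<close>

lemma alpha_H2_power2_ge:
  assumes s: "s \<ge> 1" "s \<le> 2 ^ r"
  shows "(s - 1) * 2 ^ 2 ^ r \<le> 2 ^ r * alpha s (H2 (2 ^ r))"
proof -
  define n :: nat where "n = 2 ^ r"
  define cls where "cls T = {x \<in> cube n. syndrome r x \<in> T}" for T
  have card_syndromes: "card (Pow {..<r}) = n"
    by (simp add: card_Pow n_def)
  with s(2) have "s - 1 \<le> card (Pow {..<r})"
    by (simp add: n_def)
  then obtain T where T: "T \<subseteq> Pow {..<r}" "card T = s - 1"
    by (elim obtain_subset_with_card_n)
  have finT: "finite T"
    using T(1) finite_subset by blast
  define U where "U = Pow {..<r} - T"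
  have U: "finite U" "card U = n - (s - 1)"
    using T card_syndromes by (simp_all add: U_def card_Diff_subset finT)
  have fin: "finite (cls T')" for T'
    using finite_cube by (simp add: cls_def)
  \<comment> \<open>A single class contains no edge, so the upper bound applies with 2 in place of
    \<open>s\<close>.\<close>
  have single: "n * card (cls {t}) \<le> 2 ^ n" for t
    using complete_free_card_bound[of "cls {t}" n 2] syndrome_classes_complete_free[of "{t}" 2 r]
    by (simp add: cls_def n_def)
  have "cls U = (\<Union>t\<in>U. cls {t})"
    by (auto simp: cls_def)
  then have "card (cls U) \<le> (\<Sum>t\<in>U. card (cls {t}))"
    using card_UN_le U(1) by metis
  then have "n * card (cls U) \<le> (\<Sum>t\<in>U. n * card (cls {t}))"
    by (metis mult_le_mono2 sum_distrib_left)
  also have "\<dots> \<le> (\<Sum>t\<in>U. 2 ^ n)"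
    by (intro sum_mono single)
  finally have le: "n * card (cls U) \<le> (n - (s - 1)) * 2 ^ n"
    using U(2) by simp
  have "cube n = cls T \<union> cls U" "cls T \<inter> cls U = {}"
    unfolding cls_def U_def using syndrome_in_Pow by blast+
  then have "2 ^ n = card (cls T) + card (cls U)"
    using card_Un_disjoint[OF fin fin, of T U] by (simp only: flip: card_cube)
  then have "n * 2 ^ n = n * card (cls T) + n * card (cls U)"
    by (simp add: distrib_left)
  \<comment> \<open>As \<open>s \<le> n\<close>, the subtraction is not truncated.\<close>
  moreover have "n * 2 ^ n = (s - 1) * 2 ^ n + (n - (s - 1)) * 2 ^ n"
    using s(2) by (simp add: n_def flip: distrib_right)
  ultimately have "(s - 1) * 2 ^ n \<le> n * card (cls T)"
    using le by linarith
  also have "card (cls T) \<le> alpha s (H2 n)"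
    using syndrome_classes_complete_free[of T s r] finT T(2) s(1)
    by (intro card_le_alpha_H2) (auto simp: cls_def n_def)
  finally show ?thesis
    by (simp add: n_def)
qed

section \<open>The limit superior\<close>

theorem theorem1p5:
  fixes s :: nat
  assumes "s \<ge> 1"
  shows "limsup (\<lambda>n. ereal (real (alpha s (H2 n)) / (2 ^ n / real n))) = ereal (real s - 1)"
    (is "limsup ?f = _")
proof (rule antisym)
  \<comment> \<open>At \<open>n = 0\<close> division by zero makes the quotient 0, which is within
    the bound because \<open>s \<ge> 1\<close>.\<close>
  have "?f n \<le> ereal (real s - 1)" for n
  proof -
    have "real (n * alpha s (H2 n)) \<le> real ((s - 1) * 2 ^ n)"
      using alpha_H2_le[OF assms] by (simp only: of_nat_le_iff)
    then show ?thesis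
      using assms by (simp add: field_simps)
  qed
  then show "limsup ?f \<le> ereal (real s - 1)"
    by (intro Limsup_bounded always_eventually allI)
next
  have mono: "strict_mono (\<lambda>r. 2 ^ r :: nat)"
    by (intro strict_monoI) simp
  \<comment> \<open>Along powers of two the bound is reached as soon as there are \<open>s\<close>
    colours; \<open>r \<ge> s\<close> is ample since \<open>r < 2 ^ r\<close>.\<close>
  have "ereal (real s - 1) \<le> (?f \<circ> (\<lambda>r. 2 ^ r)) r" if "r \<ge> s" for r
  proof -
    have "s \<le> 2 ^ r"
      using that less_exp[of r] by linarith
    then have "real ((s - 1) * 2 ^ 2 ^ r) \<le> real (2 ^ r * alpha s (H2 (2 ^ r)))"
      using alpha_H2_power2_ge assms by (simp only: of_nat_le_iff)
    then show ?thesis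
      using assms by (simp add: field_simps)
  qed
  then have "ereal (real s - 1) \<le> limsup (?f \<circ> (\<lambda>r. 2 ^ r))"
    by (intro le_Limsup) (auto simp: eventually_sequentially)
  also have "\<dots> \<le> limsup ?f"
    by (rule limsup_subseq_mono[OF mono])
  finally show "ereal (real s - 1) \<le> limsup ?f" .
qed

end
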